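(* Let $(p_1,p_2)\neq(3,5)$ be a twin prime pair (that is, $p_1$ and $p_2=p_1+2$ are both prime), and let $m$ be an integer with $3\le m<p_1$. Let $D\subset\mathbb C^3$ be a bounded quasi-circular domain containing the origin, with weight $(m,p_1,p_2)$. Then every holomorphic automorphism $f$ of $D$ with $f(0)=0$ is linear, i.e. is the restriction to $D$ of a $\mathbb C$-linear map $\mathbb C^3\to\mathbb C^3$.
   Context: A domain (connected open set) $D\subset\mathbb C^3$ is quasi-circular with weight $(m_1,m_2,m_3)$ (positive integers with greatest common divisor $1$) if for every $\theta\in\mathbb R$ it is invariant under the map $(z_1,z_2,z_3)\mapsto(e^{im_1\theta}z_1,e^{im_2\theta}z_2,e^{im_3\theta}z_3)$. A holomorphic automorphism of $D$ is a biholomorphic map $D\to D$. *)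

theory Defs
  imports "HOL-Analysis.Analysis" "HOL-Computational_Algebra.Primes"
begin

text \<open>The library class \<open>linear\<close> on \<open>complex ^ 'n\<close> means real-linear; complex linearity
  is linearity with respect to the scalar multiplication \<open>*s\<close>.\<close>

abbreviation complex_linear :: "(complex ^ 'n \<Rightarrow> complex ^ 'm) \<Rightarrow> bool" where
  "complex_linear \<equiv> Vector_Spaces.linear (*s) (*s)"

definition holomorphic_map_on ::
    "(complex ^ 'n \<Rightarrow> complex ^ 'm) \<Rightarrow> (complex ^ 'n) set \<Rightarrow> bool" where
  "holomorphic_map_on f D \<longleftrightarrow>
     (\<forall>z\<in>D. \<exists>L. complex_linear L \<and> (f has_derivative L) (at z))"

definition holomorphic_automorphism ::
    "(complex ^ 'n) set \<Rightarrow> (complex ^ 'n \<Rightarrow> complex ^ 'n) \<Rightarrow> bool" where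
  "holomorphic_automorphism D f \<longleftrightarrow>
     bij_betw f D D \<and> holomorphic_map_on f D \<and> holomorphic_map_on (inv_into D f) D"

definition weighted_rotation :: "nat ^ 'n \<Rightarrow> real \<Rightarrow> complex ^ 'n \<Rightarrow> complex ^ 'n" where
  "weighted_rotation w \<theta> z = (\<chi> i. exp (\<i> * of_nat (w $ i) * of_real \<theta>) * z $ i)"

definition quasi_circular_domain :: "nat ^ 'n \<Rightarrow> (complex ^ 'n) set \<Rightarrow> bool" where
  "quasi_circular_domain w D \<longleftrightarrow>
     open D \<and> connected D \<and>
     (\<forall>i. 0 < w $ i) \<and> Gcd (range (\<lambda>i. w $ i)) = 1 \<and>
     (\<forall>\<theta>. weighted_rotation w \<theta> ` D = D)"

end

(*
  Let \<Gamma> be the group of automorphisms of D fixing 0. The maps u_g = g'(0)^{-1} o g, g in \<Gamma>, are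
  uniformly bounded on D. Put q = u_f - id, and write \<rho> for a weighted rotation; then
  u_{f \<rho> g} = u_g + g'(0)^{-1} o \<rho>^{-1} o q o \<rho> o g.  Near the origin the mean of
  \<rho>^{-1} q(\<rho> z) over all rotations picks out the terms of q_i of weighted degree equal to the i-th weight,
  and since the weights (m, p1, p2) admit no resonance this mean vanishes. By orthogonality on average,
  some rotation increases the l2-norm of u_g on a fixed finite net of a small ball by an amount
  independent of g, unless q = 0. Such an increase cannot be iterated forever, so f = f'(0) on D.
*)
theory Submission
  imports Defs "HOL-Complex_Analysis.Conformal_Mappings"
begin

section \<open>Holomorphic maps along complex lines\<close>

text \<open>Why there is no resonance: a monomial of order at least 2 that involves the second or
  third variable has weighted degree at least m + p1, and m >= 3 makes this exceed p2 = p1 + 2. A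
  power of the first variable alone has degree a m with a >= 2; this is not m, and it is neither p1
  nor p2 because m divides neither prime. The derivatives g'(0) are not known to be unitary or to
  commute with rotations. Dividing them out makes the effect of a further factor f \<rho> additive,
  at the price of the factor g'(0)^{-1} in front of the new term, which bounds uniform in g control.
  A point where q is nonzero shows up in u_{f \<rho> g} - u_g only after being pulled back by
  (\<rho> g)^{-1}, so it moves with g and with the rotation. Hence the net: a Lipschitz bound common
  to all u_g lets a nearby net point detect the difference. A single rotation must serve all net
  points at once, so the inner products are summed over the net before the rotation is
  chosen.\<close>

lemma norm_vec_le_card:
  fixes x :: "'a::real_normed_vector ^ 'n" and B :: real
  assumes "\<And>i. norm (x $ i) \<le> B"
  shows "norm x \<le> CARD('n) * B"
proof -
  have "norm x \<le> (\<Sum>i\<in>UNIV. norm (x $ i))"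
    by (simp add: norm_vec_def L2_set_le_sum)
  also have "\<dots> \<le> CARD('n) * B"
    using sum_bounded_above[of UNIV "\<lambda>i. norm (x $ i)" B] assms by simp
  finally show ?thesis .
qed

lemma norm_vector_smult: "norm (c *s x) = norm c * norm x" for x :: "complex ^ 'n"
  by (simp add: norm_vec_def norm_mult L2_set_right_distrib)

lemma complex_linear_imp_linear:
  assumes "complex_linear L"
  shows "linear L"
proof -
  interpret Vector_Spaces.linear "(*s)" "(*s)" L by fact
  have scaleR: "r *\<^sub>R x = complex_of_real r *s x" for r and x :: "complex ^ 'k"
    by (simp add: vec_eq_iff) (simp add: scaleR_conv_of_real)
  show ?thesis
    by (rule linearI) (simp_all add: add scaleR scale)
qed

lemma has_field_derivative_slice:
  assumes F: "(F has_derivative L) (at (c t))" and L: "complex_linear L"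
    and c: "\<And>j. ((\<lambda>t. c t $ j) has_field_derivative c' $ j) (at t)"
  shows "((\<lambda>t. F (c t) $ i) has_field_derivative L c' $ i) (at t)"
proof -
  interpret Vector_Spaces.linear "(*s)" "(*s)" L by fact
  have "(c has_derivative (\<lambda>h. h *s c')) (at t)"
    unfolding has_derivative_componentwise_within[of c]
  proof
    fix b :: "complex ^ 'a" assume "b \<in> Basis"
    then obtain j u where b: "b = axis j u" by (auto simp: Basis_vec_def)
    show "((\<lambda>x. c x \<bullet> b) has_derivative (\<lambda>x. (x *s c') \<bullet> b)) (at t)"
      using has_derivative_inner_left[OF c[of j, unfolded has_field_derivative_def], of u]
      by (simp add: b inner_axis mult.commute)
  qed
  from has_derivative_compose[OF this F]
  have "((\<lambda>t. F (c t)) has_derivative (\<lambda>h. L (h *s c'))) (at t)" .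
  from bounded_linear.has_derivative[OF bounded_linear_vec_nth this, of i]
  show ?thesis
    by (simp add: has_field_derivative_def scale mult.commute[of _ "L c' $ i"])
qed

text \<open>The bridge to one-variable function theory: the curve \<open>c\<close> is later a
  complex line, an orbit of weighted dilations or the first coordinate axis.\<close>

lemma holomorphic_slice:
  assumes F: "holomorphic_map_on F D" and "open S" and cD: "\<And>t. t \<in> S \<Longrightarrow> c t \<in> D"
    and c: "\<And>j. (\<lambda>t. c t $ j) holomorphic_on S"
  shows "(\<lambda>t. F (c t) $ i) holomorphic_on S"
proof -
  have "\<exists>d. ((\<lambda>t. F (c t) $ i) has_field_derivative d) (at t)" if t: "t \<in> S" for t
  proof -
    obtain L where "complex_linear L" "(F has_derivative L) (at (c t))"
      using F cD[OF t] unfolding holomorphic_map_on_def by blast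
    moreover have "((\<lambda>t. c t $ j) has_field_derivative (\<chi> j. deriv (\<lambda>t. c t $ j) t) $ j) (at t)" for j
      using holomorphic_derivI[OF c \<open>open S\<close> t] by simp
    ultimately show ?thesis using has_field_derivative_slice by blast
  qed
  then show ?thesis using \<open>open S\<close> holomorphic_on_open by blast
qed

lemma Schwarz_bound:
  assumes holf: "f holomorphic_on ball 0 \<rho>" and f0: "f 0 = 0"
    and le: "\<And>z. z \<in> ball 0 \<rho> \<Longrightarrow> cmod (f z) \<le> M" and s: "s \<in> ball 0 \<rho>"
  shows "cmod (f s) \<le> M * cmod s / \<rho>"
proof (cases "s = 0")
  case True
  then show ?thesis using f0 by simp
next
  case False
  have \<rho>: "\<rho> > 0" using s by (auto intro: le_less_trans[OF norm_ge_zero])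
  have M: "M \<ge> 0" using le[OF s] norm_ge_zero order_trans by blast
  \<comment> \<open>The Schwarz lemma asks for a strict bound by 1 on the unit disc, hence the
    division by some \<open>K > M\<close>; letting \<open>K\<close> decrease to \<open>M\<close>
    gives the claim.\<close>
  have "cmod (f s) * \<rho> / cmod s \<le> K" if "M < K" for K
  proof -
    have K: "K > 0" using M that by simp
    have sub: "(\<lambda>z. complex_of_real \<rho> * z) ` ball 0 1 \<subseteq> ball 0 \<rho>"
      using \<rho> by (auto simp: norm_mult)
    have "(\<lambda>z. f (of_real \<rho> * z)) holomorphic_on ball 0 1"
      by (intro holomorphic_on_compose_gen[OF _ holf sub, unfolded o_def] holomorphic_intros)
    then have "(\<lambda>z. f (of_real \<rho> * z) / of_real K) holomorphic_on ball 0 1"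
      using K by (intro holomorphic_intros) auto
    moreover have "cmod (f (of_real \<rho> * z) / of_real K) < 1" if "cmod z < 1" for z
    proof -
      have "cmod (f (of_real \<rho> * z)) \<le> M" using that \<rho> by (intro le) (auto simp: norm_mult)
      then show ?thesis using \<open>M < K\<close> K by (simp add: norm_divide)
    qed
    moreover have "cmod (s / of_real \<rho>) < 1" using s \<rho> by (simp add: norm_divide)
    ultimately have "cmod (f (of_real \<rho> * (s / of_real \<rho>)) / of_real K) \<le> cmod (s / of_real \<rho>)"
      by (intro Schwarz_Lemma(1)) (auto simp: f0)
    then show ?thesis using \<rho> K False by (simp add: norm_divide field_simps)
  qed
  then have "cmod (f s) * \<rho> / cmod s \<le> M" by (rule dense_ge)
  then show ?thesis using \<rho> False by (simp add: field_simps)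
qed

text \<open>Two applications of \<open>Schwarz_bound\<close>: in \<open>f z = z * h z\<close> the
  first bounds \<open>h\<close> by \<open>M / \<rho>\<close>, and \<open>h 0 = deriv f 0 = 0\<close>
  lets the second apply to \<open>h\<close> itself.\<close>

lemma Schwarz_bound_order2:
  assumes holf: "f holomorphic_on ball 0 \<rho>" and f0: "f 0 = 0"
    and df0: "(f has_field_derivative 0) (at 0)"
    and le: "\<And>z. z \<in> ball 0 \<rho> \<Longrightarrow> cmod (f z) \<le> M" and s: "s \<in> ball 0 \<rho>"
  shows "cmod (f s) \<le> M * (cmod s)\<^sup>2 / \<rho>\<^sup>2"
proof -
  have \<rho>: "\<rho> > 0" using s by (auto intro: le_less_trans[OF norm_ge_zero])
  have M: "M \<ge> 0" using le[OF s] norm_ge_zero order_trans by blast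
  obtain h where h: "h holomorphic_on ball 0 \<rho>" "\<And>z. cmod z < \<rho> \<Longrightarrow> f z = z * h z"
      "deriv f 0 = h 0"
    using Schwarz3[OF holf f0] by blast
  have h0: "h 0 = 0" using h(3) DERIV_imp_deriv[OF df0] by simp
  have "cmod (h z) \<le> M / \<rho>" if "z \<in> ball 0 \<rho>" for z
  proof (cases "z = 0")
    case False
    have "cmod z * cmod (h z) \<le> M * cmod z / \<rho>"
      using Schwarz_bound[OF holf f0 le that] h(2)[of z] that by (simp add: norm_mult)
    then show ?thesis using False \<rho> by (simp add: field_simps)
  qed (use h0 M \<rho> in simp)
  from Schwarz_bound[OF h(1) h0 this s] show ?thesis
    using h(2)[of s] s \<rho> mult_left_mono[of "cmod (h s)" "M / \<rho> * cmod s / \<rho>" "cmod s"]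
    by (simp add: norm_mult power2_eq_square ac_simps)
qed

text \<open>Each component of \<open>F (a + s *s b) - F a\<close> is holomorphic in \<open>s\<close>
  on the disc of radius \<open>\<rho> / norm b\<close>, vanishes at \<open>s = 0\<close> and is
  bounded by \<open>2 * M\<close>; the Schwarz bound is read off at \<open>s = 1\<close>.\<close>

lemma holomorphic_map_increment:
  fixes F :: "complex ^ 'n \<Rightarrow> complex ^ 'm"
  assumes F: "holomorphic_map_on F D" and sub: "ball a \<rho> \<subseteq> D"
    and le: "\<And>z. z \<in> ball a \<rho> \<Longrightarrow> norm (F z) \<le> M" and b: "norm b < \<rho>"
  shows "norm (F (a + b) - F a) \<le> CARD('m) * (2 * M * norm b / \<rho>)"
proof (cases "b = 0")
  case False
  have \<rho>: "\<rho> > 0" using b norm_ge_zero le_less_trans by blast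
  show ?thesis
  proof (rule norm_vec_le_card)
    fix i
    define k where "k s = F (a + s *s b) $ i - F a $ i" for s
    have in_ball: "a + s *s b \<in> ball a \<rho>" if "s \<in> ball 0 (\<rho> / norm b)" for s
      using that False by (simp add: dist_norm norm_vector_smult field_simps)
    have "(\<lambda>s. F (a + s *s b) $ i) holomorphic_on ball 0 (\<rho> / norm b)"
      by (rule holomorphic_slice[OF F]) (use in_ball sub in \<open>auto intro!: holomorphic_intros\<close>)
    then have "k holomorphic_on ball 0 (\<rho> / norm b)"
      unfolding k_def by (intro holomorphic_intros)
    moreover have "cmod (k s) \<le> 2 * M" if "s \<in> ball 0 (\<rho> / norm b)" for s
    proof -
      have "cmod (F (a + s *s b) $ i) \<le> M"
        using le[OF in_ball[OF that]] Finite_Cartesian_Product.norm_nth_le order_trans by blast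
      moreover have "cmod (F a $ i) \<le> M"
        using le[of a] \<rho> Finite_Cartesian_Product.norm_nth_le[of "F a" i] by (auto intro: order_trans)
      ultimately show ?thesis
        unfolding k_def using norm_triangle_ineq4[of "F (a + s *s b) $ i" "F a $ i"] by linarith
    qed
    ultimately have "cmod (k 1) \<le> 2 * M * cmod 1 / (\<rho> / norm b)"
      by (intro Schwarz_bound) (use b False in \<open>auto simp: k_def[of 0]\<close>)
    then show "cmod ((F (a + b) - F a) $ i) \<le> 2 * M * norm b / \<rho>"
      by (simp add: k_def)
  qed
next
  case True
  then show ?thesis by simp
qed

lemma holomorphic_map_quadratic_bound:
  fixes q :: "complex ^ 'n \<Rightarrow> complex ^ 'm"
  assumes q: "holomorphic_map_on q (ball 0 r)" and q0: "q 0 = 0"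
    and dq: "(q has_derivative (\<lambda>_. 0)) (at 0)"
    and le: "\<And>z. z \<in> ball 0 r \<Longrightarrow> norm (q z) \<le> M" and z: "z \<in> ball 0 r"
  shows "norm (q z) \<le> CARD('m) * (M * (norm z)\<^sup>2 / r\<^sup>2)"
proof (cases "z = 0")
  case False
  show ?thesis
  proof (rule norm_vec_le_card)
    fix i
    have in_ball: "s *s z \<in> ball 0 r" if "s \<in> ball 0 (r / norm z)" for s
      using that False by (simp add: norm_vector_smult field_simps)
    have "cmod (q (1 *s z) $ i) \<le> M * (cmod 1)\<^sup>2 / (r / norm z)\<^sup>2"
    proof (rule Schwarz_bound_order2)
      show "(\<lambda>s. q (s *s z) $ i) holomorphic_on ball 0 (r / norm z)"
        by (rule holomorphic_slice[OF q]) (use in_ball in \<open>auto intro!: holomorphic_intros\<close>)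
      show "q (0 *s z) $ i = 0" by (simp add: q0)
      have L: "complex_linear (\<lambda>_ :: complex ^ 'n. 0 :: complex ^ 'm)"
        by (simp add: Vector_Spaces.linear_iff vec.vector_space_axioms)
      have c: "((\<lambda>s. (s *s z) $ j) has_field_derivative z $ j) (at 0)" for j
        by (auto intro!: derivative_eq_intros)
      show "((\<lambda>s. q (s *s z) $ i) has_field_derivative 0) (at 0)"
        using has_field_derivative_slice[of q _ "\<lambda>s. s *s z" 0 z, OF _ L c] dq by simp
      show "cmod (q (s *s z) $ i) \<le> M" if "s \<in> ball 0 (r / norm z)" for s
        using le[OF in_ball[OF that]] Finite_Cartesian_Product.norm_nth_le order_trans by blast
      show "(1::complex) \<in> ball 0 (r / norm z)" using z False by simp
    qed
    then show "cmod (q z $ i) \<le> M * (norm z)\<^sup>2 / r\<^sup>2" by (simp add: power_divide)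
  qed
qed (simp add: q0)

section \<open>Taylor coefficients and circle means\<close>

text \<open>Cauchy's inequality on a circle of radius \<open>e\<close> bounds the derivative by
  \<open>fact n * C * e\<close>, and \<open>e\<close> may be arbitrarily small.\<close>

lemma higher_deriv_eq_0_if_small:
  assumes holf: "f holomorphic_on ball 0 \<rho>" and "0 < \<delta>" "\<delta> < \<rho>"
    and small: "\<And>z. cmod z < \<delta> \<Longrightarrow> cmod (f z) \<le> C * cmod z ^ Suc n"
  shows "(deriv ^^ n) f 0 = 0"
proof -
  have C: "C \<ge> 0"
  proof -
    have "0 \<le> C * (\<delta> / 2) ^ Suc n"
      using order_trans[OF norm_ge_zero small[of "of_real (\<delta> / 2)"]] \<open>0 < \<delta>\<close> by simp
    moreover have "0 < (\<delta> / 2) ^ Suc n" using \<open>0 < \<delta>\<close> by (intro zero_less_power) simp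
    ultimately show ?thesis by (simp only: zero_le_mult_iff) auto
  qed
  \<comment> \<open>The divisor contains \<open>C + 1\<close> instead of \<open>C\<close> because
    \<open>C\<close> may be 0.\<close>
  have "cmod ((deriv ^^ n) f 0) / (fact n * (C + 1)) \<le> e" if e: "0 < e" "e < \<delta>" for e
  proof -
    have "cmod ((deriv ^^ n) f 0) \<le> fact n * (C * e ^ Suc n) / e ^ n"
    proof (rule Cauchy_inequality)
      show "f holomorphic_on ball 0 e" "continuous_on (cball 0 e) f"
        using holf e \<open>\<delta> < \<rho>\<close>
        by (auto intro!: holomorphic_on_imp_continuous_on intro: holomorphic_on_subset[OF holf])
      show "cmod (f x) \<le> C * e ^ Suc n" if "norm (0 - x) = e" for x
        using small[of x] that e by simp
    qed (use e in auto)
    also have "\<dots> = fact n * C * e" using e by simp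
    also have "\<dots> \<le> fact n * (C + 1) * e" using e by (simp add: mult_left_mono)
    finally show ?thesis using C by (simp add: pos_divide_le_eq mult_ac)
  qed
  then have "cmod ((deriv ^^ n) f 0) / (fact n * (C + 1)) \<le> 0"
    by (intro dense_ge_bounded[OF \<open>0 < \<delta>\<close>]) auto
  moreover have "0 < fact n * (C + 1)" using C by simp
  ultimately have "cmod ((deriv ^^ n) f 0) \<le> 0"
    by (simp only: divide_le_0_iff) auto
  then show ?thesis by simp
qed

text \<open>Replacing \<open>t\<close> by \<open>\<omega> * t\<close>, with \<omega> a primitive
  \<open>m\<close>-th root of unity, leaves \<open>h (t ^ m)\<close> unchanged but multiplies its
  \<open>k\<close>-th derivative at 0 by \<open>\<omega> ^ k\<close>, which is not 1.\<close>

lemma higher_deriv_comp_power_eq_0: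
  assumes holh: "h holomorphic_on ball 0 1" and "0 < m" "\<not> m dvd k"
  shows "(deriv ^^ k) (\<lambda>t. h (t ^ m)) 0 = 0"
proof -
  define \<omega> where "\<omega> = exp (2 * of_real pi * \<i> * of_nat 1 / of_nat m)"
  have \<omega>m: "\<omega> ^ m = 1"
    unfolding \<omega>_def using \<open>0 < m\<close> by (intro complex_root_unity) simp
  have \<omega>k: "\<omega> ^ k \<noteq> 1"
    using complex_root_unity_eq_1[of m k] \<open>0 < m\<close> \<open>\<not> m dvd k\<close>
    by (simp add: \<omega>_def mult_ac flip: exp_of_nat_mult)
  have \<omega>1: "cmod \<omega> = 1"
    using \<omega>m \<open>0 < m\<close> by (metis norm_ge_zero norm_one norm_power power_eq_1_iff neq0_conv)
  have hol: "(\<lambda>t. h (t ^ m)) holomorphic_on ball 0 1"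
  proof (rule holomorphic_on_compose_gen[OF _ holh, unfolded o_def])
    show "(\<lambda>t::complex. t ^ m) ` ball 0 1 \<subseteq> ball 0 1"
      using \<open>0 < m\<close> by (auto simp: norm_power power_less_one_iff)
  qed (intro holomorphic_intros)
  have "(deriv ^^ k) (\<lambda>t. h ((\<omega> * t) ^ m)) 0 = \<omega> ^ k * (deriv ^^ k) (\<lambda>t. h (t ^ m)) (\<omega> * 0)"
    by (rule higher_deriv_compose_linear[OF hol, of "ball 0 1"]) (auto simp: norm_mult \<omega>1)
  then have "(deriv ^^ k) (\<lambda>t. h (t ^ m)) 0 = \<omega> ^ k * (deriv ^^ k) (\<lambda>t. h (t ^ m)) 0"
    by (simp add: power_mult_distrib \<omega>m)
  then show ?thesis using \<omega>k by (simp add: mult_cancel_right1)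
qed

text \<open>Cauchy's formula on the unit circle, written as a Fourier coefficient;
  \<open>1 < \<rho>\<close> puts the closed unit disc inside the domain. It turns means over
  rotations into Taylor coefficients.\<close>

lemma has_integral_unit_circle_coefficient:
  assumes holf: "f holomorphic_on ball 0 \<rho>" and "1 < \<rho>"
  shows "((\<lambda>\<theta>. exp (- (\<i> * of_nat k * of_real \<theta>)) * f (exp (\<i> * of_real \<theta>)))
           has_integral (2 * of_real pi / fact k * (deriv ^^ k) f 0)) {0..2 * pi}"
proof -
  have "((\<lambda>u. f u / (u - 0) ^ Suc k) has_contour_integral
      (2 * pi * \<i> / fact k * (deriv ^^ k) f 0)) (circlepath 0 1)"
  proof (rule Cauchy_has_contour_integral_higher_derivative_circlepath)
    show "continuous_on (cball 0 1) f" "f holomorphic_on ball 0 1"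
      using \<open>1 < \<rho>\<close>
      by (auto intro!: holomorphic_on_imp_continuous_on intro: holomorphic_on_subset[OF holf])
  qed auto
  then have "((\<lambda>t. f (cis t) / cis t ^ Suc k * \<i> * cis t) has_integral
      (2 * pi * \<i> / fact k * (deriv ^^ k) f 0)) {0..2 * pi}"
    unfolding circlepath_def by (subst (asm) has_contour_integral_part_circlepath_iff) auto
  from has_integral_mult_right[OF this, of "- \<i>"]
  have "((\<lambda>t. - \<i> * (f (cis t) / cis t ^ Suc k * \<i> * cis t)) has_integral
      (- \<i> * (2 * pi * \<i> / fact k * (deriv ^^ k) f 0))) {0..2 * pi}" .
  moreover have "- \<i> * (f (cis t) / cis t ^ Suc k * \<i> * cis t) =
      exp (- (\<i> * of_nat k * of_real t)) * f (exp (\<i> * of_real t))" for t :: real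
    by (simp add: cis_conv_exp exp_minus inverse_eq_divide mult_ac flip: exp_of_nat_mult)
  moreover have "- \<i> * (2 * pi * \<i> / fact k * x) = 2 * of_real pi / fact k * x" for x
    by (simp add: mult_ac)
  ultimately show ?thesis by simp
qed

lemma has_integral_vec:
  fixes f :: "real \<Rightarrow> complex ^ 'n"
  assumes "\<And>i. ((\<lambda>x. f x $ i) has_integral (y $ i)) S"
  shows "(f has_integral y) S"
proof (subst has_integral_componentwise_iff, intro ballI)
  fix b :: "complex ^ 'n" assume "b \<in> Basis"
  then obtain j u where b: "b = axis j u" by (auto simp: Basis_vec_def)
  show "((\<lambda>x. f x \<bullet> b) has_integral (y \<bullet> b)) S"
    using has_integral_linear[OF assms[of j] bounded_linear_inner_left[of u]]
    by (simp add: b inner_axis o_def)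
qed

text \<open>Extends the weighted rotations from the unit circle to all complex \<open>t\<close>, so
  that orbits become holomorphic curves through the origin with Taylor expansions in
  \<open>t\<close>.\<close>

definition weighted_dilation :: "nat ^ 'n \<Rightarrow> complex \<Rightarrow> complex ^ 'n \<Rightarrow> complex ^ 'n" where
  "weighted_dilation w t z = (\<chi> i. t ^ (w $ i) * z $ i)"

lemma weighted_rotation_eq_dilation:
  "weighted_rotation w \<theta> z = weighted_dilation w (exp (\<i> * of_real \<theta>)) z"
  by (simp add: weighted_rotation_def weighted_dilation_def vec_eq_iff
      exp_of_nat_mult[symmetric] mult_ac)

lemma norm_weighted_rotation [simp]: "norm (weighted_rotation w \<theta> z) = norm z"
  by (simp add: norm_vec_def weighted_rotation_def norm_mult norm_exp_eq_Re)

lemma holomorphic_map_on_subset: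
  "holomorphic_map_on f D \<Longrightarrow> E \<subseteq> D \<Longrightarrow> holomorphic_map_on f E"
  by (auto simp: holomorphic_map_on_def)

text \<open>The Cauchy integral runs over the unit circle, so orbits must stay in the domain for
  \<open>t\<close> in a larger disc. Its radius is chosen to be 2, which is the source of the factor
  \<open>2 ^ p2\<close> later on.\<close>

lemma norm_weighted_dilation_le:
  fixes w :: "nat ^ 'n"
  assumes "cmod t \<le> 2" and "\<And>i. w $ i \<le> N"
  shows "norm (weighted_dilation w t z) \<le> 2 ^ N * norm z"
proof -
  have "norm (weighted_dilation w t z) \<le> norm ((2 ^ N :: complex) *s z)"
  proof (rule norm_le_componentwise_cart)
    fix i
    have "cmod t ^ (w $ i) \<le> 2 ^ (w $ i)" using assms by (intro power_mono) auto
    also have "\<dots> \<le> (2::real) ^ N" using assms by (intro power_increasing) auto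
    finally show "norm (weighted_dilation w t z $ i) \<le> norm (((2 ^ N :: complex) *s z) $ i)"
      by (simp add: weighted_dilation_def norm_mult norm_power mult_right_mono)
  qed
  then show ?thesis by (simp add: norm_vector_smult norm_power)
qed

text \<open>The orbit point splits into its first-axis part \<open>a\<close>, of size at most
  \<open>s = cmod t ^ m * norm w\<close>, and a rest \<open>b\<close> of size at most
  \<open>cmod t ^ p1 * norm w\<close>. Since \<open>q\<close> is of order \<open>s^2\<close> on a
  ball of radius \<open>2 * s\<close> about \<open>a\<close>, adding \<open>b\<close> changes it by
  order \<open>s * norm b\<close>, and the exponents \<open>m\<close> and \<open>p1\<close> add
  up.\<close>

lemma quadratic_map_weighted_increment:
  fixes q :: "complex ^ 3 \<Rightarrow> complex ^ 3" and w :: "complex ^ 3"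
  assumes q: "holomorphic_map_on q (ball 0 r)" and q0: "q 0 = 0"
    and dq: "(q has_derivative (\<lambda>_. 0)) (at 0)"
    and le: "\<And>z. z \<in> ball 0 r \<Longrightarrow> norm (q z) \<le> M"
    and m: "m \<le> p1" "p1 \<le> p2" "0 < m" and w: "norm w < r" and t: "cmod t < 1 / 8"
  shows "norm (q (weighted_dilation (vector [m, p1, p2]) t w) - q (vector [t ^ m * w $ 1, 0, 0]))
           \<le> 81 * M * (norm w)\<^sup>2 / r\<^sup>2 * cmod t ^ (m + p1)"
proof -
  define a :: "complex ^ 3" where "a = vector [t ^ m * w $ 1, 0, 0]"
  define b :: "complex ^ 3" where "b = vector [0, t ^ p1 * w $ 2, t ^ p2 * w $ 3]"
  define s where "s = cmod t ^ m * norm w"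
  have ab: "weighted_dilation (vector [m, p1, p2]) t w = a + b"
    by (simp add: weighted_dilation_def a_def b_def vec_eq_iff forall_3)
  have na: "norm a \<le> s"
  proof -
    have "\<forall>i. norm (a $ i) \<le> norm ((t ^ m *s w) $ i)"
      by (simp add: a_def forall_3 norm_mult)
    then have "norm a \<le> norm (t ^ m *s w)" using norm_le_componentwise_cart by blast
    then show ?thesis by (simp add: s_def norm_vector_smult norm_power)
  qed
  have nb: "norm b \<le> cmod t ^ p1 * norm w"
  proof -
    have "cmod t ^ p2 \<le> cmod t ^ p1" using t m by (intro power_decreasing) auto
    then have "\<forall>i. norm (b $ i) \<le> norm ((t ^ p1 *s w) $ i)"
      by (simp add: b_def forall_3 norm_mult norm_power mult_right_mono)
    then have "norm b \<le> norm (t ^ p1 *s w)" using norm_le_componentwise_cart by blast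
    then show ?thesis by (simp add: norm_vector_smult norm_power)
  qed
  have "cmod t ^ p1 \<le> cmod t ^ m" using t m by (intro power_decreasing) auto
  then have bs: "norm b \<le> s"
    unfolding s_def by (intro order_trans[OF nb] mult_right_mono) auto
  have r: "r > 0" using w norm_ge_zero le_less_trans by blast
  then have M: "M \<ge> 0" using le[of 0] order_trans[OF norm_ge_zero] by simp
  have "norm (q (a + b) - q a) \<le> 81 * M * (norm w)\<^sup>2 / r\<^sup>2 * cmod t ^ (m + p1)"
  proof (cases "s = 0")
    case True
    then have "b = 0" using bs by simp
    then show ?thesis using M by simp
  next
    case False
    have "s \<ge> 0" by (simp add: s_def)
    then have s: "s > 0" using False by linarith
    have "cmod t ^ m \<le> cmod t ^ 1" using t m by (intro power_decreasing) auto
    then have "s \<le> (1 / 8) * norm w" unfolding s_def using t by (intro mult_right_mono) auto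
    then have s8: "8 * s < r" using w by simp
    have small: "norm z < 3 * s" if "z \<in> ball a (2 * s)" for z
    proof -
      have "norm z \<le> norm a + norm (z - a)" by norm
      then show ?thesis using that na by (simp add: dist_norm norm_minus_commute)
    qed
    \<comment> \<open>The ball of radius \<open>2 * s\<close> about \<open>a\<close> lies within
      \<open>3 * s\<close> of the origin, where the quadratic bound gives \<open>3 * 9 = 27\<close>;
      the increment bound then gives \<open>3 * 2 * 27 / 2 = 81\<close>. The room needed,
      \<open>3 * s < r\<close>, comes from \<open>cmod t < 1 / 8\<close>.\<close>
    have "norm (q (a + b) - q a) \<le> CARD(3) * (2 * (27 * M * s\<^sup>2 / r\<^sup>2) * norm b / (2 * s))"
    proof (rule holomorphic_map_increment[OF q])
      show "ball a (2 * s) \<subseteq> ball 0 r" using small s s8 by force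
      show "norm b < 2 * s" using bs s by simp
      fix z assume z: "z \<in> ball a (2 * s)"
      have "norm (q z) \<le> CARD(3) * (M * (norm z)\<^sup>2 / r\<^sup>2)"
        using small[OF z] s s8 by (intro holomorphic_map_quadratic_bound[OF q q0 dq le]) auto
      also have "\<dots> \<le> CARD(3) * (M * (3 * s)\<^sup>2 / r\<^sup>2)"
        using small[OF z] M by (intro mult_left_mono divide_right_mono power_mono) auto
      finally show "norm (q z) \<le> 27 * M * s\<^sup>2 / r\<^sup>2" by (simp add: power_mult_distrib)
    qed
    also have "\<dots> = 81 * M * s / r\<^sup>2 * norm b"
      using s by (simp add: power2_eq_square field_simps)
    also have "\<dots> \<le> 81 * M * s / r\<^sup>2 * (cmod t ^ p1 * norm w)"
      using M s nb by (intro mult_left_mono) auto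
    also have "\<dots> = 81 * M * (norm w)\<^sup>2 / r\<^sup>2 * cmod t ^ (m + p1)"
      by (simp add: s_def power_add power2_eq_square)
    finally show ?thesis .
  qed
  then show ?thesis by (simp only: ab a_def)
qed

text \<open>Comparing \<open>q\<close> with its restriction to the first axis costs only \<open>O(t ^ (m + p1))\<close>, which is beyond
  all three weights; the restriction is a power series in \<open>t ^ m\<close>, and \<open>m\<close> divides neither \<open>p1\<close>
  nor \<open>p2\<close>.\<close>

lemma weighted_mean_eq_0:
  fixes q :: "complex ^ 3 \<Rightarrow> complex ^ 3" and w :: "complex ^ 3" and m p1 p2 :: nat
  defines "W \<equiv> vector [m, p1, p2] :: nat ^ 3"
  assumes q: "holomorphic_map_on q (ball 0 r)" and q0: "q 0 = 0"
    and dq: "(q has_derivative (\<lambda>_. 0)) (at 0)"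
    and le: "\<And>z. z \<in> ball 0 r \<Longrightarrow> norm (q z) \<le> M"
    and m: "0 < m" "m < p1" "p1 < p2" "p2 < p1 + m" and ndvd: "\<not> m dvd p1" "\<not> m dvd p2"
    and w: "2 ^ p2 * norm w < r"
  shows "((\<lambda>\<theta>. weighted_rotation W (- \<theta>) (q (weighted_rotation W \<theta> w)))
           has_integral 0) {0..2 * pi}"
proof (rule has_integral_vec)
  fix i
  define H where "H t = q (weighted_dilation W t w) $ i" for t
  define h where "h x = q (vector [x * w $ 1, 0, 0]) $ i" for x
  define G where "G t = H t - h (t ^ m)" for t
  have w_less: "norm w < r"
    using w mult_right_mono[of 1 "2 ^ p2" "norm w"] by simp
  have M: "M \<ge> 0"
    using le[of 0] w_less order_trans[OF norm_ge_zero] by (simp add: le_less_trans[OF norm_ge_zero])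
  have axis_le: "norm (vector [x * w $ 1, 0, 0] :: complex ^ 3) \<le> cmod x * norm w" for x
  proof -
    have "\<forall>j. norm ((vector [x * w $ 1, 0, 0] :: complex ^ 3) $ j) \<le> norm ((x *s w) $ j)"
      by (simp add: forall_3 norm_mult)
    then show ?thesis using norm_le_componentwise_cart norm_vector_smult by metis
  qed
  have hol_H: "H holomorphic_on ball 0 2"
    unfolding H_def
  proof (rule holomorphic_slice[OF q open_ball])
    have "W $ j \<le> p2" for j
      using m exhaust_3[of j] by (auto simp: W_def)
    then show "weighted_dilation W t w \<in> ball 0 r" if "t \<in> ball 0 2" for t
      using norm_weighted_dilation_le[of t W p2 w] that w by simp
  qed (auto simp: weighted_dilation_def intro!: holomorphic_intros)
  have hol_h: "h holomorphic_on ball 0 1"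
    unfolding h_def
  proof (rule holomorphic_slice[OF q open_ball])
    show "(vector [x * w $ 1, 0, 0] :: complex ^ 3) \<in> ball 0 r" if "x \<in> ball 0 1" for x
      using axis_le[of x] that w_less mult_right_mono[of "cmod x" 1 "norm w"] by simp
    show "(\<lambda>x. (vector [x * w $ 1, 0, 0] :: complex ^ 3) $ j) holomorphic_on ball 0 1" for j
      using exhaust_3[of j] by (auto intro!: holomorphic_intros)
  qed
  have hol_hm: "(\<lambda>t. h (t ^ m)) holomorphic_on ball 0 1"
  proof (rule holomorphic_on_compose_gen[OF _ hol_h, unfolded o_def])
    show "(\<lambda>t::complex. t ^ m) ` ball 0 1 \<subseteq> ball 0 1"
      using \<open>0 < m\<close> by (auto simp: norm_power power_less_one_iff)
  qed (intro holomorphic_intros)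
  have hol_G: "G holomorphic_on ball 0 1"
    unfolding G_def
    by (intro holomorphic_intros hol_hm holomorphic_on_subset[OF hol_H]) auto
  have "(deriv ^^ (W $ i)) G 0 = 0"
  proof (rule higher_deriv_eq_0_if_small[OF hol_G, of "1 / 8"])
    fix t assume t: "cmod t < 1 / 8"
    define K where "K = 81 * M * (norm w)\<^sup>2 / r\<^sup>2"
    have "W $ i < m + p1" using m exhaust_3[of i] by (auto simp: W_def)
    then have *: "cmod t ^ (m + p1) \<le> cmod t ^ Suc (W $ i)"
      using t by (intro power_decreasing) auto
    have "cmod (G t) \<le> norm (q (weighted_dilation W t w) - q (vector [t ^ m * w $ 1, 0, 0]))"
      unfolding G_def H_def h_def
      using Finite_Cartesian_Product.norm_nth_le by (metis vector_minus_component)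
    also have "\<dots> \<le> K * cmod t ^ (m + p1)"
      unfolding W_def K_def
      using m w_less t by (intro quadratic_map_weighted_increment[OF q q0 dq le]) auto
    also have "\<dots> \<le> K * cmod t ^ Suc (W $ i)"
      using * M by (intro mult_left_mono) (auto simp: K_def)
    finally show "cmod (G t) \<le> K * cmod t ^ Suc (W $ i)" .
  qed auto
  moreover have "(deriv ^^ (W $ i)) (\<lambda>t. h (t ^ m)) 0 = 0"
  proof (cases "m dvd W $ i")
    case False
    then show ?thesis using higher_deriv_comp_power_eq_0[OF hol_h] m by simp
  next
    \<comment> \<open>Only the first weight is left, where divisibility does not kill the
      coefficient. Instead \<open>q\<close> vanishes to second order, so \<open>h (t ^ m)\<close> is
      of order \<open>2 * m\<close>, beyond the weight \<open>m\<close>.\<close>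
    case True
    then have Wi: "W $ i = m" using ndvd exhaust_3[of i] by (auto simp: W_def)
    show ?thesis
    proof (rule higher_deriv_eq_0_if_small[OF hol_hm, of "1 / 8"])
      fix t assume t: "cmod t < 1 / 8"
      define K where "K = 3 * M * (norm w)\<^sup>2 / r\<^sup>2"
      define v :: "complex ^ 3" where "v = vector [t ^ m * w $ 1, 0, 0]"
      have nv: "norm v \<le> cmod t ^ m * norm w" using axis_le[of "t ^ m"] by (simp add: v_def norm_power)
      have "cmod t ^ m \<le> 1" using t by (intro power_le_one) auto
      then have "norm v < r" using nv w_less mult_right_mono[of "cmod t ^ m" 1 "norm w"] by simp
      have "cmod (h (t ^ m)) \<le> norm (q v)"
        unfolding h_def v_def by (rule Finite_Cartesian_Product.norm_nth_le)
      also have "\<dots> \<le> CARD(3) * (M * (norm v)\<^sup>2 / r\<^sup>2)"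
        using \<open>norm v < r\<close> by (intro holomorphic_map_quadratic_bound[OF q q0 dq le]) auto
      also have "\<dots> \<le> CARD(3) * (M * (cmod t ^ m * norm w)\<^sup>2 / r\<^sup>2)"
        using nv M by (intro mult_left_mono divide_right_mono power_mono) auto
      also have "\<dots> = K * cmod t ^ (m + m)"
        by (simp add: K_def power_mult_distrib power_add power2_eq_square)
      also have "\<dots> \<le> K * cmod t ^ Suc (W $ i)"
        using M t m by (intro mult_left_mono power_decreasing) (auto simp: K_def Wi)
      finally show "cmod (h (t ^ m)) \<le> K * cmod t ^ Suc (W $ i)" .
    qed auto
  qed
  moreover have "(deriv ^^ (W $ i)) (\<lambda>t. G t + h (t ^ m)) 0 =
      (deriv ^^ (W $ i)) G 0 + (deriv ^^ (W $ i)) (\<lambda>t. h (t ^ m)) 0"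
    by (rule higher_deriv_add[OF hol_G hol_hm]) auto
  ultimately have "(deriv ^^ (W $ i)) H 0 = 0"
    by (simp add: G_def)
  \<comment> \<open>In component \<open>i\<close> the rotation by \<open>- \<theta>\<close> is
    multiplication by the character of index \<open>W $ i\<close>, so the integral is a Fourier
    coefficient of \<open>H\<close> on the unit circle.\<close>
  with has_integral_unit_circle_coefficient[OF hol_H, of "W $ i"]
  show "((\<lambda>\<theta>. weighted_rotation W (- \<theta>) (q (weighted_rotation W \<theta> w)) $ i)
      has_integral 0 $ i) {0..2 * pi}"
    by (simp add: H_def weighted_rotation_eq_dilation[of W _ w])
      (simp add: weighted_rotation_def)
qed

section \<open>Automorphisms fixing the origin\<close>

lemma holomorphic_map_on_compose:
  assumes g: "holomorphic_map_on g D" and f: "holomorphic_map_on f E" and sub: "g ` D \<subseteq> E"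
  shows "holomorphic_map_on (\<lambda>z. f (g z)) D"
  unfolding holomorphic_map_on_def
proof
  fix z assume z: "z \<in> D"
  obtain A where A: "complex_linear A" "(g has_derivative A) (at z)"
    using g z by (auto simp: holomorphic_map_on_def)
  obtain B where B: "complex_linear B" "(f has_derivative B) (at (g z))"
    using f z sub unfolding holomorphic_map_on_def by blast
  have "complex_linear (\<lambda>v. B (A v))"
    using Vector_Spaces.linear_compose[OF A(1) B(1)] by (simp add: o_def)
  then show "\<exists>L. complex_linear L \<and> ((\<lambda>z. f (g z)) has_derivative L) (at z)"
    using has_derivative_compose[OF A(2) B(2)] by blast
qed

lemma complex_linear_has_derivative:
  "complex_linear L \<Longrightarrow> (L has_derivative L) (at z)" for L :: "complex ^ 'n \<Rightarrow> complex ^ 'm"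
  using complex_linear_imp_linear linear_conv_bounded_linear bounded_linear_imp_has_derivative by blast

lemma complex_linear_holomorphic_map_on:
  "complex_linear L \<Longrightarrow> holomorphic_map_on L D"
  using complex_linear_has_derivative by (auto simp: holomorphic_map_on_def)

lemma holomorphic_map_on_minus_id:
  assumes "holomorphic_map_on f D"
  shows "holomorphic_map_on (\<lambda>z. f z - z) D"
  unfolding holomorphic_map_on_def
proof
  fix z assume z: "z \<in> D"
  obtain A where A: "complex_linear A" "(f has_derivative A) (at z)"
    using assms z by (auto simp: holomorphic_map_on_def)
  have "complex_linear (\<lambda>v. A v - v)"
    using A(1) by (simp add: Vector_Spaces.linear_iff vector_ssub_ldistrib)
  then show "\<exists>L. complex_linear L \<and> ((\<lambda>z. f z - z) has_derivative L) (at z)"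
    using has_derivative_diff[OF A(2) has_derivative_ident] by blast
qed

lemma complex_linear_weighted_rotation: "complex_linear (weighted_rotation w \<theta>)"
  by (simp add: Vector_Spaces.linear_iff vec.vector_space_axioms weighted_rotation_def
      vec_eq_iff distrib_left distrib_right mult_ac)

lemma weighted_rotation_minus [simp]:
  "weighted_rotation w (- \<theta>) (weighted_rotation w \<theta> z) = z"
  "weighted_rotation w \<theta> (weighted_rotation w (- \<theta>) z) = z"
  by (simp_all add: weighted_rotation_def vec_eq_iff exp_minus)

section \<open>Derivative bounds at the origin and the identity theorem in several variables\<close>

lemma has_derivative_norm_bound:
  fixes f :: "'a::real_normed_vector \<Rightarrow> 'b::real_normed_vector"
  assumes f: "(f has_derivative f') (at 0)" and f0: "f 0 = 0" and "r > 0"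
    and le: "\<And>z. norm z < r \<Longrightarrow> norm (f z) \<le> K * norm z"
  shows "norm (f' v) \<le> K * norm v"
proof (cases "v = 0")
  case True
  then show ?thesis using linear_simps(3)[OF has_derivative_bounded_linear[OF f]] by simp
next
  case False
  interpret bounded_linear f' using f by (rule has_derivative_bounded_linear)
  have "norm (f' v) / norm v \<le> K + e" if e: "e > 0" for e
  proof -
    obtain d where d: "d > 0" "\<And>y. norm y < d \<Longrightarrow> norm (f y - f' y) \<le> e * norm y"
      using f e f0 by (auto simp: has_derivative_at_alt)
    \<comment> \<open>Half the smaller radius, so that \<open>s *\<^sub>R v\<close> lies in both
      balls; by linearity of \<open>f'\<close> the positive factor \<open>s\<close> cancels
      afterwards.\<close>
    define s where "s = min d r / (2 * norm v)"
    have s: "s > 0" using d \<open>r > 0\<close> False by (simp add: s_def)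
    have "norm (s *\<^sub>R v) < d" "norm (s *\<^sub>R v) < r"
      using d(1) \<open>r > 0\<close> False by (auto simp: s_def)
    then have "norm (f' (s *\<^sub>R v)) \<le> (K + e) * norm (s *\<^sub>R v)"
      using d(2)[of "s *\<^sub>R v"] le[of "s *\<^sub>R v"] norm_triangle_sub[of "f' (s *\<^sub>R v)" "f (s *\<^sub>R v)"]
      by (simp add: algebra_simps norm_minus_commute)
    then have "norm (f' v) \<le> (K + e) * norm v"
      using s by (simp add: scaleR mult.left_commute[of _ s])
    then show ?thesis using False by (simp add: divide_le_eq)
  qed
  then have "norm (f' v) / norm v \<le> K" by (rule field_le_epsilon)
  then show ?thesis using False by (simp add: divide_le_eq)
qed

text \<open>The interior \<open>S\<close> of the zero set is relatively closed in \<open>D\<close>: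
  if \<open>s\<close> is in \<open>S\<close>, analytic continuation along the complex lines through
  \<open>s\<close> makes \<open>q\<close> vanish on every ball about \<open>s\<close> inside
  \<open>D\<close>. Connectedness then gives \<open>S = D\<close>.\<close>

lemma holomorphic_map_identity_theorem:
  assumes q: "holomorphic_map_on q D" and D: "open D" "connected D"
    and "0 < e" "ball a e \<subseteq> D" and zero: "\<And>z. z \<in> ball a e \<Longrightarrow> q z = 0" and "z \<in> D"
  shows "q z = 0"
proof -
  define S where "S = interior {z \<in> D. q z = 0}"
  have S_sub: "S \<subseteq> {z \<in> D. q z = 0}" unfolding S_def by (rule interior_subset)
  have line: "q y = 0" if \<rho>: "ball s \<rho> \<subseteq> D" and s: "s \<in> S" and y: "y \<in> ball s \<rho>" for s \<rho> y
  proof (cases "y = s")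
    case True
    then show ?thesis using s S_sub by auto
  next
    case False
    define v where "v = y - s"
    have v: "norm v > 0" "norm v < \<rho>" using False y by (auto simp: v_def dist_norm norm_minus_commute)
    obtain d where d: "d > 0" "ball s d \<subseteq> S"
      using s open_interior open_contains_ball unfolding S_def by blast
    define d' where "d' = min d \<rho>"
    have d': "d' > 0" "ball s d' \<subseteq> S" "d' \<le> \<rho>" using d v le_less_trans[OF norm_ge_zero v(2)] by (auto simp: d'_def)
    have "q (s + 1 *s v) $ i = 0" for i
    proof (rule analytic_continuation_open[where g = "\<lambda>_. 0" and z = 1 and f = "\<lambda>t. q (s + t *s v) $ i"])
      show "ball 0 (d' / norm v) \<noteq> ({} :: complex set)" using d' v by (simp add: divide_le_0_iff)
      show "ball (0 :: complex) (d' / norm v) \<subseteq> ball 0 (\<rho> / norm v)"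
        using d' v by (intro subset_ball divide_right_mono) auto
      show "(\<lambda>t. q (s + t *s v) $ i) holomorphic_on ball 0 (\<rho> / norm v)"
      proof (rule holomorphic_slice[OF q])
        show "s + t *s v \<in> D" if "t \<in> ball 0 (\<rho> / norm v)" for t
          using that v \<rho> by (intro subsetD[OF \<rho>]) (simp add: dist_norm norm_vector_smult field_simps)
      qed (auto intro!: holomorphic_intros)
      show "q (s + t *s v) $ i = 0" if "t \<in> ball 0 (d' / norm v)" for t
      proof -
        have "s + t *s v \<in> S"
          using that v by (intro subsetD[OF d'(2)]) (simp add: dist_norm norm_vector_smult field_simps)
        then show ?thesis using S_sub by auto
      qed
      show "(1 :: complex) \<in> ball 0 (\<rho> / norm v)" using v by simp
    qed auto
    then show ?thesis by (simp add: vec_eq_iff v_def)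
  qed
  have "open (D - S)"
    unfolding open_contains_ball
  proof
    fix x assume x: "x \<in> D - S"
    \<comment> \<open>Twice the radius, so that for every \<open>s\<close> within \<rho> of
      \<open>x\<close> the ball about \<open>s\<close> of radius \<rho> still lies in
      \<open>D\<close>; that ball contains \<open>x\<close>.\<close>
    obtain \<rho> where \<rho>: "\<rho> > 0" "ball x (2 * \<rho>) \<subseteq> D"
    proof -
      obtain e where "e > 0" "ball x e \<subseteq> D" using x D open_contains_ball by blast
      then show ?thesis using that[of "e / 2"] by simp
    qed
    have "s \<notin> S" if s: "s \<in> ball x \<rho>" for s
    proof
      assume "s \<in> S"
      have sub: "ball s \<rho> \<subseteq> D"
      proof
        fix y assume "y \<in> ball s \<rho>"
        then have "y \<in> ball x (2 * \<rho>)"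
          using s dist_triangle[of x y s] by simp
        then show "y \<in> D" using \<rho> by blast
      qed
      have "ball s \<rho> \<subseteq> {z \<in> D. q z = 0}" using line[OF sub \<open>s \<in> S\<close>] sub by blast
      then have "ball s \<rho> \<subseteq> S" unfolding S_def by (intro interior_maximal) auto
      then show False using x s by (auto simp: dist_commute)
    qed
    moreover have "ball x \<rho> \<subseteq> ball x (2 * \<rho>)" using \<rho> by (intro subset_ball) simp
    ultimately have "ball x \<rho> \<subseteq> D - S" using \<rho> by blast
    then show "\<exists>e>0. ball x e \<subseteq> D - S" using \<rho> by blast
  qed
  moreover have "open S" by (simp add: S_def)
  moreover have "a \<in> S"
    unfolding S_def using \<open>0 < e\<close> \<open>ball a e \<subseteq> D\<close> zero by (intro interiorI[of "ball a e"]) auto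
  ultimately have "D - S = {}"
    using connectedD[OF D(2), of S "D - S"] S_sub by blast
  then show ?thesis using \<open>z \<in> D\<close> S_sub by blast
qed

section \<open>Automorphisms with their inverses, and estimates uniform over the group\<close>

text \<open>Carrying the inverse \<open>h\<close> along makes \<open>deriv_at_0 h\<close> available as the inverse of \<open>deriv_at_0 g\<close>.\<close>

definition automorphism_pair ::
    "(complex ^ 'n) set \<Rightarrow> (complex ^ 'n \<Rightarrow> complex ^ 'n) \<Rightarrow> (complex ^ 'n \<Rightarrow> complex ^ 'n) \<Rightarrow> bool" where
  "automorphism_pair D g h \<longleftrightarrow>
     holomorphic_map_on g D \<and> holomorphic_map_on h D \<and> g ` D \<subseteq> D \<and> h ` D \<subseteq> D \<and>
     (\<forall>z\<in>D. h (g z) = z \<and> g (h z) = z) \<and> g 0 = 0 \<and> h 0 = 0"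

lemma automorphism_pair_sym: "automorphism_pair D g h \<Longrightarrow> automorphism_pair D h g"
  by (auto simp: automorphism_pair_def)

lemma automorphism_pair_compose:
  assumes "automorphism_pair D g h" "automorphism_pair D g' h'"
  shows "automorphism_pair D (\<lambda>z. g (g' z)) (\<lambda>z. h' (h z))"
  using assms unfolding automorphism_pair_def
  by (auto intro: holomorphic_map_on_compose simp: image_subset_iff)

lemma automorphism_pair_weighted_rotation:
  assumes "\<And>\<theta>. weighted_rotation w \<theta> ` D = D"
  shows "automorphism_pair D (weighted_rotation w \<theta>) (weighted_rotation w (- \<theta>))"
  unfolding automorphism_pair_def
  using assms by (auto simp: complex_linear_holomorphic_map_on complex_linear_weighted_rotation)
    (simp_all add: weighted_rotation_def vec_eq_iff)

lemma automorphism_pair_inv_into: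
  assumes f: "holomorphic_automorphism D f" and "0 \<in> D" "f 0 = 0"
  shows "automorphism_pair D f (inv_into D f)"
proof -
  have bij: "bij_betw f D D" using f by (simp add: holomorphic_automorphism_def)
  then have "inv_into D f 0 = 0"
    using assms(2,3) bij_betw_inv_into_left by metis
  moreover have "inv_into D f ` D \<subseteq> D" "f ` D \<subseteq> D"
    using bij_betw_imp_surj_on[OF bij_betw_inv_into[OF bij]] bij_betw_imp_surj_on[OF bij] by auto
  ultimately show ?thesis
    using f \<open>f 0 = 0\<close> bij_betw_inv_into_left[OF bij] bij_betw_inv_into_right[OF bij]
    by (simp add: automorphism_pair_def holomorphic_automorphism_def)
qed

abbreviation deriv_at_0 :: "(complex ^ 'n \<Rightarrow> complex ^ 'm) \<Rightarrow> complex ^ 'n \<Rightarrow> complex ^ 'm" where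
  "deriv_at_0 g \<equiv> frechet_derivative g (at 0)"

lemma automorphism_pair_deriv:
  assumes "automorphism_pair D g h" and "0 \<in> D"
  shows "complex_linear (deriv_at_0 g)" and "(g has_derivative deriv_at_0 g) (at 0)"
proof -
  obtain L where "complex_linear L" "(g has_derivative L) (at 0)"
    using assms unfolding automorphism_pair_def holomorphic_map_on_def by blast
  moreover from this have "L = deriv_at_0 g" using frechet_derivative_at by blast
  ultimately show "complex_linear (deriv_at_0 g)" "(g has_derivative deriv_at_0 g) (at 0)"
    by simp_all
qed

lemma automorphism_pair_deriv_compose:
  assumes g: "automorphism_pair D g h" and g': "automorphism_pair D g' h'" and "0 \<in> D"
  shows "deriv_at_0 (\<lambda>z. g (g' z)) = (\<lambda>v. deriv_at_0 g (deriv_at_0 g' v))"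
proof -
  have "g' 0 = 0" using g' by (simp add: automorphism_pair_def)
  then have "((\<lambda>z. g (g' z)) has_derivative (\<lambda>v. deriv_at_0 g (deriv_at_0 g' v))) (at 0)"
    using has_derivative_compose[of g' "deriv_at_0 g'" 0 UNIV g "deriv_at_0 g"]
      automorphism_pair_deriv(2)[OF g] automorphism_pair_deriv(2)[OF g'] \<open>0 \<in> D\<close> by simp
  then show ?thesis using frechet_derivative_at by metis
qed

lemma automorphism_pair_deriv_inverse:
  assumes g: "automorphism_pair D g h" and "open D" "0 \<in> D"
  shows "deriv_at_0 h (deriv_at_0 g v) = v"
proof -
  have "((\<lambda>z. z) has_derivative (\<lambda>v. v)) (at 0 within UNIV)" by simp
  then have "((\<lambda>z. h (g z)) has_derivative (\<lambda>v. v)) (at 0 within UNIV)"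
    by (rule has_derivative_transform_within_open[OF _ \<open>open D\<close> \<open>0 \<in> D\<close>])
      (use g in \<open>simp add: automorphism_pair_def\<close>)
  then have "(\<lambda>v. v) = deriv_at_0 (\<lambda>z. h (g z))" by (rule frechet_derivative_at)
  also have "\<dots> = (\<lambda>v. deriv_at_0 h (deriv_at_0 g v))"
    by (rule automorphism_pair_deriv_compose[OF automorphism_pair_sym[OF g] g \<open>0 \<in> D\<close>])
  finally show ?thesis by metis
qed

text \<open>The map here is u_g, with \<open>deriv_at_0 h\<close> in the place of
  g'(0)^{-1}.\<close>

lemma automorphism_pair_normalized_holomorphic:
  assumes g: "automorphism_pair D g h" and "0 \<in> D"
  shows "holomorphic_map_on (\<lambda>z. deriv_at_0 h (g z)) D"
proof (rule holomorphic_map_on_compose[of g D "deriv_at_0 h" D])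
  show "holomorphic_map_on g D" "g ` D \<subseteq> D" using g by (auto simp: automorphism_pair_def)
  show "holomorphic_map_on (deriv_at_0 h) D"
    by (intro complex_linear_holomorphic_map_on
        automorphism_pair_deriv(1)[OF automorphism_pair_sym[OF g] \<open>0 \<in> D\<close>])
qed

text \<open>All constants depend on \<open>D\<close> alone. As \<open>g\<close> maps into the
  bounded set \<open>D\<close>, the Schwarz bound gives \<open>K\<close> for \<open>g\<close> near 0
  and hence for its derivative; exchanging \<open>g\<close> and \<open>h\<close> bounds
  \<open>deriv_at_0 h\<close> as well, which yields \<open>B\<close>, and the increment bound on
  balls of radius \<open>r / 2\<close> yields \<Lambda>.\<close>

lemma automorphism_pair_bounds:
  fixes D :: "(complex ^ 'n) set"
  assumes "open D" "0 \<in> D" "bounded D"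
  obtains r K \<Lambda> B where "r > 0" "ball 0 r \<subseteq> D" "K \<ge> 1" "\<Lambda> > 0"
    and "\<And>g h z. automorphism_pair D g h \<Longrightarrow> norm z < r \<Longrightarrow> norm (g z) \<le> K * norm z"
    and "\<And>g h v. automorphism_pair D g h \<Longrightarrow> norm (deriv_at_0 g v) \<le> K * norm v"
    and "\<And>g h z. automorphism_pair D g h \<Longrightarrow> z \<in> D \<Longrightarrow> norm (deriv_at_0 h (g z)) \<le> B"
    and "\<And>g h z z'. automorphism_pair D g h \<Longrightarrow> norm z \<le> r / 2 \<Longrightarrow> dist z z' < r / 2 \<Longrightarrow>
           norm (deriv_at_0 h (g z') - deriv_at_0 h (g z)) \<le> \<Lambda> * dist z z'"
proof -
  obtain r where r: "r > 0" "ball 0 r \<subseteq> D"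
    using assms open_contains_ball by blast
  obtain R where R: "R > 0" "\<And>z. z \<in> D \<Longrightarrow> norm z \<le> R"
    using \<open>bounded D\<close> bounded_pos by blast
  define K where "K = max 1 (CARD('n) * (2 * R / r))"
  define B where "B = K * R"
  define \<Lambda> where "\<Lambda> = CARD('n) * (2 * B / (r / 2))"
  have K: "K \<ge> 1" by (simp add: K_def)
  then have B: "B > 0" using R by (simp add: B_def)
  have \<Lambda>: "\<Lambda> > 0" using B r by (simp add: \<Lambda>_def)
  have bound: "norm (g z) \<le> K * norm z" if g: "automorphism_pair D g h" and z: "norm z < r" for g h z
  proof -
    have "norm (g (0 + z) - g 0) \<le> CARD('n) * (2 * R * norm z / r)"
    proof (rule holomorphic_map_increment[OF _ r(2) _ z])
      show "holomorphic_map_on g D" using g by (simp add: automorphism_pair_def)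
      show "norm (g z) \<le> R" if "z \<in> ball 0 r" for z
        using g that r R by (auto simp: automorphism_pair_def image_subset_iff)
    qed
    then have "norm (g z) \<le> CARD('n) * (2 * R / r) * norm z"
      using g by (simp add: automorphism_pair_def)
    also have "\<dots> \<le> K * norm z" by (intro mult_right_mono) (auto simp: K_def)
    finally show ?thesis .
  qed
  have deriv_bound: "norm (deriv_at_0 g v) \<le> K * norm v" if g: "automorphism_pair D g h" for g h v
  proof (rule has_derivative_norm_bound[OF automorphism_pair_deriv(2)[OF g \<open>0 \<in> D\<close>] _ r(1)])
    show "g 0 = 0" using g by (simp add: automorphism_pair_def)
  qed (rule bound[OF g])
  have u_bound: "norm (deriv_at_0 h (g z)) \<le> B" if g: "automorphism_pair D g h" and z: "z \<in> D" for g h z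
  proof -
    have "norm (deriv_at_0 h (g z)) \<le> K * norm (g z)"
      by (rule deriv_bound[OF automorphism_pair_sym[OF g]])
    also have "\<dots> \<le> B"
      unfolding B_def using g z R K
      by (intro mult_left_mono) (auto simp: automorphism_pair_def image_subset_iff)
    finally show ?thesis .
  qed
  have u_lipschitz: "norm (deriv_at_0 h (g z') - deriv_at_0 h (g z)) \<le> \<Lambda> * dist z z'"
    if g: "automorphism_pair D g h" and z: "norm z \<le> r / 2" "dist z z' < r / 2" for g h z z'
  proof -
    have sub: "ball z (r / 2) \<subseteq> D"
    proof
      fix y assume "y \<in> ball z (r / 2)"
      then have "norm y < r"
        using z norm_triangle_sub[of y z] by (simp add: dist_norm norm_minus_commute)
      then show "y \<in> D" using r by auto
    qed
    have "norm (deriv_at_0 h (g (z + (z' - z))) - deriv_at_0 h (g z)) \<le>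
        CARD('n) * (2 * B * norm (z' - z) / (r / 2))"
    proof (rule holomorphic_map_increment[OF _ sub])
      show "holomorphic_map_on (\<lambda>z. deriv_at_0 h (g z)) D"
        by (rule automorphism_pair_normalized_holomorphic[OF g \<open>0 \<in> D\<close>])
      show "norm (deriv_at_0 h (g y)) \<le> B" if "y \<in> ball z (r / 2)" for y
        using u_bound[OF g] sub that by blast
      show "norm (z' - z) < r / 2" using z by (simp add: dist_norm norm_minus_commute)
    qed
    also have "\<dots> = \<Lambda> * dist z z'"
      by (simp add: \<Lambda>_def dist_norm norm_minus_commute)
    finally show ?thesis by simp
  qed
  show ?thesis
    by (rule that[of r K \<Lambda> B]) (fact r K \<Lambda> bound deriv_bound u_bound u_lipschitz)+
qed

section \<open>The energy argument\<close>

lemma exists_mean_le: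
  assumes "(\<psi> has_integral 0) {0..2 * pi}" and "0 < (e :: real)"
  obtains \<theta> :: real where "- e \<le> \<psi> \<theta>"
proof (rule ccontr)
  assume "\<not> thesis"
  \<comment> \<open>Tolerating \<open>- e\<close> in place of 0 provides a negative constant above
    \<psi>, so that comparing integrals is enough; the loss is absorbed by the energy gain.\<close>
  then have "\<psi> \<theta> \<le> - e" for \<theta> using that[of \<theta>] by linarith
  then have "0 \<le> (- e) * (2 * pi)"
    using has_integral_le[OF assms(1) has_integral_const_real[of "- e" 0 "2 * pi"]] by simp
  then show False using mult_pos_pos[OF pi_gt_zero \<open>0 < e\<close>] by simp
qed

text \<open>The weights enter only through \<open>mean\<close>. The iteration is compressed into one
  step: the supremum of the energies need not be attained, so a pair within \<open>e / 2\<close> of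
  it is taken and a gain of more than \<open>e / 2\<close> is produced.\<close>

lemma linear_if_weighted_mean_eq_0:
  fixes f f' :: "complex ^ 'n \<Rightarrow> complex ^ 'n" and w :: "nat ^ 'n"
  defines "q \<equiv> \<lambda>z. deriv_at_0 f' (f z) - z"
  assumes D: "open D" "connected D" "0 \<in> D" "bounded D"
    and rot: "\<And>\<theta>. weighted_rotation w \<theta> ` D = D"
    and f: "automorphism_pair D f f'" and "\<delta> > 0"
    and mean: "\<And>z. norm z < \<delta> \<Longrightarrow>
      ((\<lambda>\<theta>. weighted_rotation w (- \<theta>) (q (weighted_rotation w \<theta> z))) has_integral 0) {0..2 * pi}"
    and "z \<in> D"
  shows "f z = deriv_at_0 f z"
proof -
  obtain r K \<Lambda> B where r: "r > 0" "ball 0 r \<subseteq> D" and K: "K \<ge> 1" and \<Lambda>: "\<Lambda> > 0"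
    and bound: "\<And>g h z. automorphism_pair D g h \<Longrightarrow> norm z < r \<Longrightarrow> norm (g z) \<le> K * norm z"
    and deriv_bound: "\<And>g h v. automorphism_pair D g h \<Longrightarrow> norm (deriv_at_0 g v) \<le> K * norm v"
    and u_bound: "\<And>g h z. automorphism_pair D g h \<Longrightarrow> z \<in> D \<Longrightarrow> norm (deriv_at_0 h (g z)) \<le> B"
    and u_lipschitz: "\<And>g h z z'. automorphism_pair D g h \<Longrightarrow> norm z \<le> r / 2 \<Longrightarrow> dist z z' < r / 2 \<Longrightarrow>
           norm (deriv_at_0 h (g z') - deriv_at_0 h (g z)) \<le> \<Lambda> * dist z z'"
    by (fact automorphism_pair_bounds[OF D(1,3,4)])
  \<comment> \<open>The net will lie in the ball of radius \<epsilon>: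
    \<open>K * \<epsilon> < \<delta>\<close> keeps its images under every \<open>g\<close> where the
    mean vanishes, and \<open>\<epsilon> \<le> r / 2\<close> makes the Lipschitz bound available at
    its points.\<close>
  define \<epsilon> where "\<epsilon> = min \<delta> r / (2 * K)"
  have \<epsilon>: "\<epsilon> > 0" "K * \<epsilon> < \<delta>" "\<epsilon> \<le> r / 2"
  proof -
    show "\<epsilon> > 0" using \<open>\<delta> > 0\<close> r K by (simp add: \<epsilon>_def)
    have "K * \<epsilon> = min \<delta> r / 2" using K by (simp add: \<epsilon>_def)
    then show "K * \<epsilon> < \<delta>" using \<open>\<delta> > 0\<close> r by linarith
    have "min \<delta> r / (2 * K) \<le> r / 2" using r K \<open>\<delta> > 0\<close> by (intro frac_le) auto
    then show "\<epsilon> \<le> r / 2" by (simp add: \<epsilon>_def)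
  qed
  \<comment> \<open>Pulling \<open>w0\<close> back by an automorphism fixing 0 enlarges its norm at
    most by the factor \<open>K\<close>, so starting within \<open>\<epsilon> / K\<close> ends
    inside the ball covered by the net.\<close>
  have zero: "q w0 = 0" if w0: "w0 \<in> ball 0 (\<epsilon> / K)" for w0
  proof (rule ccontr)
    assume "q w0 \<noteq> 0"
    \<comment> \<open>A lower bound, independent of \<open>g\<close>, for the increment at the point
      pulled back from \<open>w0\<close>: applying \<open>deriv_at_0 g\<close> there returns
      \<open>q w0\<close> up to a rotation and expands by at most \<open>K\<close>.\<close>
    define \<eta> where "\<eta> = norm (q w0) / K"
    have \<eta>: "\<eta> > 0" using \<open>q w0 \<noteq> 0\<close> K by (simp add: \<eta>_def)
    \<comment> \<open>The increment is a difference of two normalized automorphisms, hence has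
      Lipschitz constant \<open>2 * \<Lambda>\<close>; moving to a net point within \<open>d\<close>
      costs at most half of \<eta>.\<close>
    define d where "d = min (r / 2) (\<eta> / (4 * \<Lambda>))"
    have d: "d > 0" "d \<le> r / 2" "2 * \<Lambda> * d \<le> \<eta> / 2"
      using r \<eta> \<Lambda> by (auto simp: d_def min_def field_simps)
    have "compact (cball (0 :: complex ^ 'n) \<epsilon>)" by simp
    then obtain F where F: "finite F" "F \<subseteq> cball 0 \<epsilon>" "cball (0 :: complex ^ 'n) \<epsilon> \<subseteq> (\<Union>x\<in>F. ball x d)"
      using seq_compact_imp_totally_bounded[of "cball (0 :: complex ^ 'n) \<epsilon>"] \<open>d > 0\<close>
      unfolding compact_eq_seq_compact_metric by blast
    have FD: "p \<in> D" if "p \<in> F" for p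
      using that F(2) \<epsilon> r by (intro subsetD[OF r(2)]) auto
    define energy where "energy g h = (\<Sum>p\<in>F. (norm (deriv_at_0 h (g p)))\<^sup>2)" for g h :: "complex ^ 'n \<Rightarrow> complex ^ 'n"
    define E where "E = {energy g h | g h. automorphism_pair D g h}"
    have "energy g h \<le> card F * B\<^sup>2" if "automorphism_pair D g h" for g h
      unfolding energy_def using FD u_bound[OF that]
      by (intro sum_bounded_above power_mono) auto
    then have "bdd_above E" by (intro bdd_aboveI[of _ "card F * B\<^sup>2"]) (auto simp: E_def)
    have "E \<noteq> {}" using f by (auto simp: E_def)
    define e where "e = (\<eta> / 2)\<^sup>2"
    have e: "e > 0" using \<eta> by (simp add: e_def)
    obtain g h where gh: "automorphism_pair D g h" "Sup E - e / 2 < energy g h"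
      using less_cSupD[OF \<open>E \<noteq> {}\<close>, of "Sup E - e / 2"] e by (auto simp: E_def)
    define Q where "Q \<theta> p = deriv_at_0 h (weighted_rotation w (- \<theta>) (q (weighted_rotation w \<theta> (g p))))" for \<theta> p
    have lin_h: "complex_linear (deriv_at_0 h)"
      by (rule automorphism_pair_deriv(1)[OF automorphism_pair_sym[OF gh(1)] \<open>0 \<in> D\<close>])
    have "((\<lambda>\<theta>. \<Sum>p\<in>F. deriv_at_0 h (g p) \<bullet> Q \<theta> p) has_integral (\<Sum>p\<in>F. 0)) {0..2 * pi}"
    proof (rule has_integral_sum[OF F(1)])
      fix p assume "p \<in> F"
      then have p: "norm p \<le> \<epsilon>" using F(2) by auto
      have "norm (g p) \<le> K * norm p" using p \<epsilon> r by (intro bound[OF gh(1)]) auto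
      also have "\<dots> \<le> K * \<epsilon>" using p K by (intro mult_left_mono) auto
      finally have gp: "norm (g p) < \<delta>" using \<epsilon> by linarith
      \<comment> \<open>This functional does not depend on \<theta>, so it commutes with the
        integral and the vanishing mean makes the averaged inner product vanish.\<close>
      have bl: "bounded_linear (\<lambda>x. deriv_at_0 h (g p) \<bullet> deriv_at_0 h x)"
        using complex_linear_imp_linear[OF lin_h]
        by (intro bounded_linear_compose[OF bounded_linear_inner_right])
          (simp add: linear_conv_bounded_linear)
      show "((\<lambda>\<theta>. deriv_at_0 h (g p) \<bullet> Q \<theta> p) has_integral 0) {0..2 * pi}"
        using has_integral_linear[OF mean[OF gp] bl] linear_simps(3)[OF bl]
        by (simp add: Q_def o_def)
    qed
    then obtain \<theta> where \<theta>: "- (e / 8) \<le> (\<Sum>p\<in>F. deriv_at_0 h (g p) \<bullet> Q \<theta> p)"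
      using exists_mean_le[of "\<lambda>\<theta>. \<Sum>p\<in>F. deriv_at_0 h (g p) \<bullet> Q \<theta> p" "e / 8"] e by auto
    define g2 where "g2 = (\<lambda>z. f (weighted_rotation w \<theta> (g z)))"
    define h2 where "h2 = (\<lambda>z. h (weighted_rotation w (- \<theta>) (f' z)))"
    have rot_pair: "automorphism_pair D (weighted_rotation w \<theta>) (weighted_rotation w (- \<theta>))"
      by (rule automorphism_pair_weighted_rotation[OF rot])
    have rg: "automorphism_pair D (\<lambda>z. weighted_rotation w \<theta> (g z)) (\<lambda>z. h (weighted_rotation w (- \<theta>) z))"
      by (rule automorphism_pair_compose[OF rot_pair gh(1)])
    have g2h2: "automorphism_pair D g2 h2"
      unfolding g2_def h2_def by (rule automorphism_pair_compose[OF f rg])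
    have deriv_rot: "deriv_at_0 (weighted_rotation w (- \<theta>)) = weighted_rotation w (- \<theta>)"
      using frechet_derivative_at[OF complex_linear_has_derivative[OF complex_linear_weighted_rotation]]
      by metis
    have "deriv_at_0 h2 = (\<lambda>v. deriv_at_0 h (weighted_rotation w (- \<theta>) (deriv_at_0 f' v)))"
      unfolding h2_def
      using automorphism_pair_deriv_compose[OF automorphism_pair_sym[OF rg] automorphism_pair_sym[OF f] \<open>0 \<in> D\<close>]
        automorphism_pair_deriv_compose[OF automorphism_pair_sym[OF gh(1)] automorphism_pair_sym[OF rot_pair] \<open>0 \<in> D\<close>]
      by (simp add: deriv_rot)
    then have Q_eq: "deriv_at_0 h2 (g2 p) = deriv_at_0 h (g p) + Q \<theta> p" for p
      by (simp add: Q_def q_def g2_def linear_diff[OF complex_linear_imp_linear[OF lin_h]]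
          linear_diff[OF complex_linear_imp_linear[OF complex_linear_weighted_rotation]])
    have "\<exists>p\<in>F. \<eta> / 2 \<le> norm (Q \<theta> p)"
    proof -
      \<comment> \<open>The preimage of \<open>w0\<close> under \<open>g\<close> followed by the
        rotation; it depends on \<open>g\<close> and \<theta>, and is therefore replaced by a net
        point.\<close>
      define x where "x = h (weighted_rotation w (- \<theta>) w0)"
      have w0r: "norm w0 < \<epsilon> / K" using w0 by simp
      have "\<epsilon> / K \<le> \<epsilon>" using \<epsilon> K by (simp add: divide_le_eq)
      then have w0r': "norm w0 < r" using w0r \<epsilon> r by linarith
      have "norm x \<le> K * norm w0"
        using bound[OF automorphism_pair_sym[OF rg] w0r'] by (simp add: x_def)
      also have "\<dots> < \<epsilon>" using w0r K by (simp add: less_divide_eq mult.commute)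
      finally have x: "x \<in> cball 0 \<epsilon>" by simp
      then obtain p where p: "p \<in> F" "dist p x < d" using F(3) by auto
      have "norm p \<le> r / 2" using p F(2) \<epsilon> by auto
      then have "norm (deriv_at_0 h2 (g2 x) - deriv_at_0 h2 (g2 p)) \<le> \<Lambda> * dist p x"
        "norm (deriv_at_0 h (g x) - deriv_at_0 h (g p)) \<le> \<Lambda> * dist p x"
        using u_lipschitz[OF g2h2, of p x] u_lipschitz[OF gh(1), of p x] p d by auto
      then have "norm (Q \<theta> x - Q \<theta> p) \<le> 2 * \<Lambda> * dist p x"
        using norm_triangle_ineq4[of "deriv_at_0 h2 (g2 x) - deriv_at_0 h2 (g2 p)"
            "deriv_at_0 h (g x) - deriv_at_0 h (g p)"]
        by (simp add: Q_eq algebra_simps)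
      also have "\<dots> \<le> 2 * \<Lambda> * d" using p \<Lambda> by (intro mult_left_mono) auto
      also have "\<dots> \<le> \<eta> / 2" by (rule d)
      finally have close: "norm (Q \<theta> x - Q \<theta> p) \<le> \<eta> / 2" .
      have "weighted_rotation w \<theta> (g x) = w0"
        using rg w0r' r unfolding automorphism_pair_def x_def by auto
      then have "norm (q w0) = norm (deriv_at_0 g (Q \<theta> x))"
        using automorphism_pair_deriv_inverse[OF automorphism_pair_sym[OF gh(1)] D(1,3)]
        by (simp add: Q_def)
      also have "\<dots> \<le> K * norm (Q \<theta> x)" by (rule deriv_bound[OF gh(1)])
      finally have "\<eta> \<le> norm (Q \<theta> x)" using K by (simp add: \<eta>_def divide_le_eq mult.commute)
      then have "\<eta> / 2 \<le> norm (Q \<theta> p)"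
        using close norm_triangle_sub[of "Q \<theta> x" "Q \<theta> p"] by linarith
      then show ?thesis using p by blast
    qed
    then obtain p where p: "p \<in> F" "\<eta> / 2 \<le> norm (Q \<theta> p)" by blast
    have "e \<le> (norm (Q \<theta> p))\<^sup>2" unfolding e_def using p \<eta> by (intro power_mono) auto
    also have "\<dots> \<le> (\<Sum>p\<in>F. (norm (Q \<theta> p))\<^sup>2)"
      using F(1) p(1) by (intro member_le_sum) auto
    finally have Q_large: "e \<le> (\<Sum>p\<in>F. (norm (Q \<theta> p))\<^sup>2)" .
    have "energy g2 h2 = energy g h + 2 * (\<Sum>p\<in>F. deriv_at_0 h (g p) \<bullet> Q \<theta> p) + (\<Sum>p\<in>F. (norm (Q \<theta> p))\<^sup>2)"
      by (simp add: energy_def Q_eq power2_norm_eq_inner inner_add_left inner_add_right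
          inner_commute sum.distrib sum_distrib_left algebra_simps)
    \<comment> \<open>The gain is at least \<open>e - 2 * (e / 8)\<close>, which exceeds the
      shortfall \<open>e / 2\<close> of \<open>energy g h\<close>.\<close>
    then have "Sup E < energy g2 h2" using gh(2) \<theta> Q_large e by linarith
    moreover have "energy g2 h2 \<le> Sup E"
      using g2h2 \<open>bdd_above E\<close> by (intro cSup_upper) (auto simp: E_def)
    ultimately show False by simp
  qed
  have "holomorphic_map_on q D"
    unfolding q_def
    by (intro holomorphic_map_on_minus_id automorphism_pair_normalized_holomorphic[OF f \<open>0 \<in> D\<close>])
  then have "q z = 0"
  proof (rule holomorphic_map_identity_theorem[OF _ D(1,2) _ _ zero \<open>z \<in> D\<close>])
    show "0 < \<epsilon> / K" using \<epsilon> K by simp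
    have "\<epsilon> / K \<le> \<epsilon>" using \<epsilon> K by (simp add: divide_le_eq)
    then show "ball 0 (\<epsilon> / K) \<subseteq> D" using r \<epsilon> by (intro order_trans[OF subset_ball r(2)]) linarith
  qed
  then have "deriv_at_0 f (deriv_at_0 f' (f z)) = deriv_at_0 f z" by (simp add: q_def)
  then show ?thesis
    using automorphism_pair_deriv_inverse[OF automorphism_pair_sym[OF f] D(1,3)] by simp
qed

theorem corollary3p4:
  fixes p1 p2 m :: nat
    and D :: "(complex ^ 3) set"
    and f :: "complex ^ 3 \<Rightarrow> complex ^ 3"
  assumes "prime p1" and "prime p2" and "p2 = p1 + 2"
    and "(p1, p2) \<noteq> (3, 5)"
    and "3 \<le> m" and "m < p1"
    and "quasi_circular_domain (vector [m, p1, p2]) D"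
    and "bounded D" and "0 \<in> D"
    and "holomorphic_automorphism D f" and "f 0 = 0"
  shows "\<exists>L. complex_linear L \<and> (\<forall>z\<in>D. f z = L z)"
proof -
  define W :: "nat ^ 3" where "W = vector [m, p1, p2]"
  define f' where "f' = inv_into D f"
  have D: "open D" "connected D" and rot: "\<And>\<theta>. weighted_rotation W \<theta> ` D = D"
    using assms(7) by (auto simp: quasi_circular_domain_def W_def)
  have f: "automorphism_pair D f f'"
    unfolding f'_def using assms by (intro automorphism_pair_inv_into)
  define q where "q z = deriv_at_0 f' (f z) - z" for z
  obtain r R where r: "r > 0" "ball 0 r \<subseteq> D" and R: "\<And>z. z \<in> D \<Longrightarrow> norm z \<le> R"
    using D(1) \<open>0 \<in> D\<close> \<open>bounded D\<close> open_contains_ball bounded_pos by metis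
  have lin: "complex_linear (deriv_at_0 f')" "(f has_derivative deriv_at_0 f) (at 0)"
    using automorphism_pair_deriv[OF f \<open>0 \<in> D\<close>]
      automorphism_pair_deriv[OF automorphism_pair_sym[OF f] \<open>0 \<in> D\<close>] by auto
  have hol: "holomorphic_map_on q D"
    unfolding q_def
    by (intro holomorphic_map_on_minus_id automorphism_pair_normalized_holomorphic[OF f \<open>0 \<in> D\<close>])
  have q0: "q 0 = 0"
    using \<open>f 0 = 0\<close> linear_0[OF complex_linear_imp_linear[OF lin(1)]] by (simp add: q_def)
  have "((\<lambda>z. deriv_at_0 f' (f z) - z) has_derivative (\<lambda>v. deriv_at_0 f' (deriv_at_0 f v) - v)) (at 0)"
    by (intro has_derivative_diff has_derivative_ident
        has_derivative_compose[OF lin(2) complex_linear_has_derivative[OF lin(1)]])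
  then have dq: "(q has_derivative (\<lambda>_. 0)) (at 0)"
    using automorphism_pair_deriv_inverse[OF f D(1) \<open>0 \<in> D\<close>] by (simp add: q_def[abs_def])
  obtain M where M: "\<And>z. z \<in> D \<Longrightarrow> norm (q z) \<le> M"
  proof -
    obtain r' K B \<Lambda> where "\<And>g h z. automorphism_pair D g h \<Longrightarrow> z \<in> D \<Longrightarrow> norm (deriv_at_0 h (g z)) \<le> B"
      using automorphism_pair_bounds[OF D(1) \<open>0 \<in> D\<close> \<open>bounded D\<close>] by metis
    then have "norm (q z) \<le> B + R" if "z \<in> D" for z
      unfolding q_def using R f that by (intro order_trans[OF norm_triangle_ineq4 add_mono])
    then show ?thesis using that by blast
  qed
  \<comment> \<open>A divisor of a prime is 1 or the prime itself, and
    \<open>3 \<le> m < p1 < p2\<close> rules out both. The same bound \<open>3 \<le> m\<close> gives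
    \<open>p2 < p1 + m\<close> below.\<close>
  have ndvd: "\<not> m dvd p1" "\<not> m dvd p2"
    using assms by (auto simp: prime_nat_iff)
  \<comment> \<open>The radius \<open>r / 2 ^ p2\<close> keeps the dilation orbits with
    \<open>cmod t < 2\<close> inside the ball of radius \<open>r\<close>.\<close>
  have mean: "((\<lambda>\<theta>. weighted_rotation W (- \<theta>) (q (weighted_rotation W \<theta> z))) has_integral 0) {0..2 * pi}"
    if "norm z < r / 2 ^ p2" for z
    unfolding W_def
  proof (rule weighted_mean_eq_0[OF holomorphic_map_on_subset[OF hol r(2)] q0 dq M])
    show "2 ^ p2 * norm z < r" using that by (simp add: field_simps)
  qed (use r assms ndvd in auto)
  have "f z = deriv_at_0 f z" if "z \<in> D" for z
    using r by (intro linear_if_weighted_mean_eq_0[OF D \<open>0 \<in> D\<close> \<open>bounded D\<close> rot f _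
          mean[unfolded q_def] that]) auto
  then show ?thesis using automorphism_pair_deriv(1)[OF f \<open>0 \<in> D\<close>] by blast
qed

end
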